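(* Let $X$ be a metrizable space with an equicontinuous group action of a topological group $G$. Then the action is of characteristic $0$ and is $R$-closed, and the orbit class space $X/\hat{G}$ is Hausdorff. Moreover, if every orbit closure is compact, then the action is weakly almost periodic.
   Context: A group action is a continuous map $G\times X\to X$, $(g,x)\mapsto g(x)$, with $e(x)=x$ and $g(h(x))=(gh)(x)$. The orbit of $x$ is $G(x)=\{g(x)\mid g\in G\}$. The action on a metrizable space $X$ is equicontinuous if there is a metric $d$ compatible with the topology of $X$ such that for every $\varepsilon>0$ there is $\delta>0$ with $d(g(x),g(y))<\varepsilon$ for all $g\in G$ and all $x,y\in X$ with $d(x,y)<\delta$. The action is $R$-closed if $\{(x,y)\in X\times X\mid y\in\overline{G(x)}\}$ is closed in $X\times X$. The (bilateral) prolongation of $x$ is $D(x)=\{y\in X\mid\text{there are nets }(x_\alpha),(y_\alpha)\text{ in }X\text{ (with the same index set) such that } y_\alpha\in G(x_\alpha),\ y_\alpha\to y,\ x_\alpha\to x\}$; the action is of characteristic $0$ if $\overline{G(x)}=D(x)$ for every $x\in X$. The orbit class of $x$ is $\{y\in X\mid\overline{G(x)}=\overline{G(y)}\}$; the orbit class space $X/\hat{G}$ is the quotient space of $X$ obtained by collapsing each orbit class to a point, with the quotient topology. An invariant subset $A$ of $X$ is minimal if $A=\overline{G(x)}$ for every $x\in A$. The action is pointwise almost periodic if every orbit closure is minimal, and weakly almost periodic if it is pointwise almost periodic and $\bigcup_{x\in A}\overline{G(x)}$ is closed for every closed $A\subseteq X$. *)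

theory Defs
  imports "HOL-Analysis.Analysis" "HOL-Algebra.Group_Action"
begin

section \<open>Continuous actions of topological groups\<close>

text \<open>No separation axiom is imposed on the topology of the group.\<close>

locale topological_group = group G for G (structure) +
  fixes T :: "'g topology"
  assumes topspace_eq_carrier: "topspace T = carrier G"
    and continuous_mult: "continuous_map (prod_topology T T) T (\<lambda>(g, h). g \<otimes> h)"
    and continuous_inv: "continuous_map T T (\<lambda>g. inv g)"

text \<open>
  The values of \<open>act g\<close> outside \<open>topspace X\<close> are irrelevant, whereas the library's
  \<^locale>\<open>group_action\<close> asks them to be \<open>undefined\<close>; see \<open>group_action_restrict\<close> below.
\<close>

locale continuous_action = topological_group G T
  for G (structure) and T :: "'g topology" +
  fixes X :: "'a topology" and act :: "'g \<Rightarrow> 'a \<Rightarrow> 'a"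
  assumes continuous_act: "continuous_map (prod_topology T X) X (\<lambda>(g, x). act g x)"
    and act_one: "x \<in> topspace X \<Longrightarrow> act \<one> x = x"
    and act_mult: "\<lbrakk>g \<in> carrier G; h \<in> carrier G; x \<in> topspace X\<rbrakk>
                     \<Longrightarrow> act g (act h x) = act (g \<otimes> h) x"
begin

lemma act_closed: "\<lbrakk>g \<in> carrier G; x \<in> topspace X\<rbrakk> \<Longrightarrow> act g x \<in> topspace X"
  using continuous_map_image_subset_topspace[OF continuous_act]
  by (force simp: topspace_eq_carrier)

lemma group_action_restrict: "group_action G (topspace X) (\<lambda>g. restrict (act g) (topspace X))"
proof -
  have bij: "restrict (act g) (topspace X) \<in> Bij (topspace X)" if g: "g \<in> carrier G" for g
  proof -
    have "bij_betw (act g) (topspace X) (topspace X)"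
      by (rule bij_betw_byWitness[where f' = "act (inv g)"])
        (use g in \<open>auto simp: act_mult act_one act_closed\<close>)
    then show ?thesis
      by (simp add: Bij_def bij_betw_restrict_eq)
  qed
  have "(\<lambda>g. restrict (act g) (topspace X)) \<in> hom G (BijGroup (topspace X))"
  proof (rule homI)
    fix g h assume gh: "g \<in> carrier G" "h \<in> carrier G"
    show "restrict (act (g \<otimes> h)) (topspace X)
        = restrict (act g) (topspace X) \<otimes>\<^bsub>BijGroup (topspace X)\<^esub> restrict (act h) (topspace X)"
      using bij[OF gh(1)] bij[OF gh(2)] gh
      by (auto simp: BijGroup_def compose_def restrict_def fun_eq_iff act_mult act_closed)
  qed (simp add: BijGroup_def bij)
  then show ?thesis
    by (simp add: group_action_def group_hom_def group_hom_axioms_def group_BijGroup is_group)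
qed

end

definition equicontinuous_action ::
  "('g, 'm) monoid_scheme \<Rightarrow> 'a topology \<Rightarrow> ('g \<Rightarrow> 'a \<Rightarrow> 'a) \<Rightarrow> bool" where
  "equicontinuous_action G X act \<longleftrightarrow>
    (\<exists>d. Metric_space (topspace X) d \<and> Metric_space.mtopology (topspace X) d = X \<and>
      (\<forall>\<epsilon>>0. \<exists>\<delta>>0. \<forall>g\<in>carrier G. \<forall>x\<in>topspace X. \<forall>y\<in>topspace X.
         d x y < \<delta> \<longrightarrow> d (act g x) (act g y) < \<epsilon>))"

definition orbit_closure ::
  "('g, 'm) monoid_scheme \<Rightarrow> 'a topology \<Rightarrow> ('g \<Rightarrow> 'a \<Rightarrow> 'a) \<Rightarrow> 'a \<Rightarrow> 'a set" where
  "orbit_closure G X act x = X closure_of (orbit G act x)"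

definition R_closed_action ::
  "('g, 'm) monoid_scheme \<Rightarrow> 'a topology \<Rightarrow> ('g \<Rightarrow> 'a \<Rightarrow> 'a) \<Rightarrow> bool" where
  "R_closed_action G X act \<longleftrightarrow>
    closedin (prod_topology X X)
      {(x, y). x \<in> topspace X \<and> y \<in> topspace X \<and> y \<in> orbit_closure G X act x}"


section \<open>Nets and prolongations\<close>

definition directed_index :: "'i set \<Rightarrow> ('i \<Rightarrow> 'i \<Rightarrow> bool) \<Rightarrow> bool" where
  "directed_index I r \<longleftrightarrow>
    I \<noteq> {} \<and> (\<forall>i\<in>I. r i i) \<and>
    (\<forall>i\<in>I. \<forall>j\<in>I. \<forall>k\<in>I. r i j \<and> r j k \<longrightarrow> r i k) \<and>
    (\<forall>i\<in>I. \<forall>j\<in>I. \<exists>k\<in>I. r i k \<and> r j k)"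

text \<open>The filter of tails, so that convergence of nets is an instance of \<^const>\<open>limitin\<close>.\<close>

definition tails :: "'i set \<Rightarrow> ('i \<Rightarrow> 'i \<Rightarrow> bool) \<Rightarrow> 'i filter" where
  "tails I r = (INF i\<in>I. principal {j\<in>I. r i j})"

lemma eventually_tails:
  assumes "directed_index I r"
  shows "eventually P (tails I r) \<longleftrightarrow> (\<exists>i\<in>I. \<forall>j\<in>I. r i j \<longrightarrow> P j)"
proof -
  have "eventually P (tails I r) \<longleftrightarrow> (\<exists>i\<in>I. eventually P (principal {j\<in>I. r i j}))"
    unfolding tails_def
  proof (rule eventually_INF_base)
    show "I \<noteq> {}"
      using assms by (simp add: directed_index_def)
    fix a b assume ab: "a \<in> I" "b \<in> I"
    then obtain k where k: "k \<in> I" "r a k" "r b k"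
      using assms unfolding directed_index_def by blast
    then have "{j\<in>I. r k j} \<subseteq> {j\<in>I. r a j} \<inter> {j\<in>I. r b j}"
      using assms ab unfolding directed_index_def by blast
    then show "\<exists>x\<in>I. principal {j\<in>I. r x j}
                 \<le> inf (principal {j\<in>I. r a j}) (principal {j\<in>I. r b j})"
      using k by (intro bexI[of _ k]) (simp_all add: inf_principal)
  qed
  then show ?thesis
    by (auto simp: eventually_principal)
qed

text \<open>
  HOL cannot quantify over the index type inside a definition. Index sets of subsets of
  \<open>X \<times> X\<close> suffice: by \<open>prolongationI\<close> below, nets over any other directed set yield no
  further points.
\<close>

definition prolongation ::
  "('g, 'm) monoid_scheme \<Rightarrow> 'a topology \<Rightarrow> ('g \<Rightarrow> 'a \<Rightarrow> 'a) \<Rightarrow> 'a \<Rightarrow> 'a set" where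
  "prolongation G X act x =
    {y \<in> topspace X. \<exists>(I :: ('a \<times> 'a) set set) r u v.
       directed_index I r \<and>
       (\<forall>i\<in>I. u i \<in> topspace X \<and> v i \<in> topspace X \<and> v i \<in> orbit G act (u i)) \<and>
       limitin X v y (tails I r) \<and> limitin X u x (tails I r)}"

lemma prolongationI:
  fixes I :: "'i set"
  assumes I: "directed_index I r"
    and uv: "\<And>i. i \<in> I \<Longrightarrow> u i \<in> topspace X \<and> v i \<in> topspace X \<and> v i \<in> orbit G act (u i)"
    and v: "limitin X v y (tails I r)" and u: "limitin X u x (tails I r)"
  shows "y \<in> prolongation G X act x"
proof -
  let ?P = "prod_topology X X"
  define J where "J = {W. openin ?P W \<and> (x, y) \<in> W}"
  have xy: "x \<in> topspace X" "y \<in> topspace X"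
    using u v by (auto simp: limitin_def)
  have J: "directed_index J (\<lambda>V W. W \<subseteq> V)"
    unfolding directed_index_def
  proof (intro conjI)
    show "J \<noteq> {}"
      using xy openin_topspace[of ?P] by (auto simp: J_def)
    show "\<forall>V\<in>J. \<forall>W\<in>J. \<exists>U\<in>J. U \<subseteq> V \<and> U \<subseteq> W"
    proof (intro ballI)
      fix V W assume "V \<in> J" "W \<in> J"
      then have "V \<inter> W \<in> J"
        by (auto simp: J_def)
      then show "\<exists>U\<in>J. U \<subseteq> V \<and> U \<subseteq> W"
        by blast
    qed
  qed auto
  have "\<exists>p. p \<in> W \<and> fst p \<in> topspace X \<and> snd p \<in> topspace X \<and> snd p \<in> orbit G act (fst p)"
    if W: "W \<in> J" for W
  proof -
    obtain A B where AB: "openin X A" "openin X B" "x \<in> A" "y \<in> B" "A \<times> B \<subseteq> W"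
      using W unfolding J_def openin_prod_topology_alt by blast
    have "eventually (\<lambda>i. u i \<in> A) (tails I r)" "eventually (\<lambda>i. v i \<in> B) (tails I r)"
      using u v AB by (auto simp: limitin_def)
    then have "eventually (\<lambda>i. u i \<in> A \<and> v i \<in> B) (tails I r)"
      by (rule eventually_conj)
    then obtain i where "i \<in> I" "\<forall>j\<in>I. r i j \<longrightarrow> u j \<in> A \<and> v j \<in> B"
      unfolding eventually_tails[OF I] by blast
    moreover from \<open>i \<in> I\<close> have "r i i"
      using I unfolding directed_index_def by blast
    ultimately have "i \<in> I" "u i \<in> A" "v i \<in> B"
      by blast+
    then show ?thesis
      using AB uv[of i] by (intro exI[of _ "(u i, v i)"]) auto
  qed
  then obtain p where p: "\<And>W. W \<in> J \<Longrightarrow> p W \<in> W \<and> fst (p W) \<in> topspace X \<and>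
      snd (p W) \<in> topspace X \<and> snd (p W) \<in> orbit G act (fst (p W))"
    by metis
  have "limitin X (\<lambda>W. snd (p W)) y (tails J (\<lambda>V W. W \<subseteq> V))"
    unfolding limitin_def eventually_tails[OF J]
  proof (intro conjI allI impI)
    fix B assume B: "openin X B \<and> y \<in> B"
    then have "topspace X \<times> B \<in> J"
      using xy by (auto simp: J_def openin_prod_Times_iff)
    moreover have "snd (p W) \<in> B" if "W \<in> J" "W \<subseteq> topspace X \<times> B" for W
      using p[OF that(1)] that(2) by (auto simp: mem_Times_iff)
    ultimately show "\<exists>V\<in>J. \<forall>W\<in>J. W \<subseteq> V \<longrightarrow> snd (p W) \<in> B"
      by blast
  qed (rule xy)
  moreover have "limitin X (\<lambda>W. fst (p W)) x (tails J (\<lambda>V W. W \<subseteq> V))"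
    unfolding limitin_def eventually_tails[OF J]
  proof (intro conjI allI impI)
    fix A assume A: "openin X A \<and> x \<in> A"
    then have "A \<times> topspace X \<in> J"
      using xy by (auto simp: J_def openin_prod_Times_iff)
    moreover have "fst (p W) \<in> A" if "W \<in> J" "W \<subseteq> A \<times> topspace X" for W
      using p[OF that(1)] that(2) by (auto simp: mem_Times_iff)
    ultimately show "\<exists>V\<in>J. \<forall>W\<in>J. W \<subseteq> V \<longrightarrow> fst (p W) \<in> A"
      by blast
  qed (rule xy)
  moreover have "\<forall>W\<in>J. fst (p W) \<in> topspace X \<and> snd (p W) \<in> topspace X \<and>
      snd (p W) \<in> orbit G act (fst (p W))"
    using p by blast
  ultimately show ?thesis
    unfolding prolongation_def mem_Collect_eq using xy J
    by (intro conjI exI[of _ J] exI[of _ "\<lambda>V W. W \<subseteq> V"]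
        exI[of _ "\<lambda>W. fst (p W)"] exI[of _ "\<lambda>W. snd (p W)"])
qed

definition characteristic_0 ::
  "('g, 'm) monoid_scheme \<Rightarrow> 'a topology \<Rightarrow> ('g \<Rightarrow> 'a \<Rightarrow> 'a) \<Rightarrow> bool" where
  "characteristic_0 G X act \<longleftrightarrow>
    (\<forall>x\<in>topspace X. orbit_closure G X act x = prolongation G X act x)"


section \<open>The orbit class space\<close>

definition orbit_class ::
  "('g, 'm) monoid_scheme \<Rightarrow> 'a topology \<Rightarrow> ('g \<Rightarrow> 'a \<Rightarrow> 'a) \<Rightarrow> 'a \<Rightarrow> 'a set" where
  "orbit_class G X act x =
    {y \<in> topspace X. orbit_closure G X act x = orbit_closure G X act y}"

definition orbit_class_space ::
  "('g, 'm) monoid_scheme \<Rightarrow> 'a topology \<Rightarrow> ('g \<Rightarrow> 'a \<Rightarrow> 'a) \<Rightarrow> 'a set topology" where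
  "orbit_class_space G X act =
    topology (\<lambda>\<U>. \<U> \<subseteq> orbit_class G X act ` topspace X \<and>
                   openin X {x \<in> topspace X. orbit_class G X act x \<in> \<U>})"

lemma openin_orbit_class_space:
  "openin (orbit_class_space G X act) \<U> \<longleftrightarrow>
     \<U> \<subseteq> orbit_class G X act ` topspace X \<and>
     openin X {x \<in> topspace X. orbit_class G X act x \<in> \<U>}"
proof -
  let ?q = "orbit_class G X act"
  have "istopology (\<lambda>\<U>. \<U> \<subseteq> ?q ` topspace X \<and> openin X {x \<in> topspace X. ?q x \<in> \<U>})"
    unfolding istopology_def
  proof (intro conjI allI impI)
    fix S T
    assume "S \<subseteq> ?q ` topspace X \<and> openin X {x \<in> topspace X. ?q x \<in> S}"
      and "T \<subseteq> ?q ` topspace X \<and> openin X {x \<in> topspace X. ?q x \<in> T}"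
    moreover have "{x \<in> topspace X. ?q x \<in> S \<inter> T}
        = {x \<in> topspace X. ?q x \<in> S} \<inter> {x \<in> topspace X. ?q x \<in> T}"
      by blast
    ultimately show "S \<inter> T \<subseteq> ?q ` topspace X" "openin X {x \<in> topspace X. ?q x \<in> S \<inter> T}"
      by auto
  next
    fix \<K>
    assume K: "\<forall>S\<in>\<K>. S \<subseteq> ?q ` topspace X \<and> openin X {x \<in> topspace X. ?q x \<in> S}"
    then show "\<Union>\<K> \<subseteq> ?q ` topspace X"
      by blast
    have "{x \<in> topspace X. ?q x \<in> \<Union>\<K>} = (\<Union>S\<in>\<K>. {x \<in> topspace X. ?q x \<in> S})"
      by blast
    then show "openin X {x \<in> topspace X. ?q x \<in> \<Union>\<K>}"
      using K by auto
  qed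
  then show ?thesis
    by (simp add: orbit_class_space_def topology_inverse')
qed

lemma topspace_orbit_class_space:
  "topspace (orbit_class_space G X act) = orbit_class G X act ` topspace X"
proof -
  have "{x \<in> topspace X. orbit_class G X act x \<in> orbit_class G X act ` topspace X} = topspace X"
    by blast
  then have "openin (orbit_class_space G X act) (orbit_class G X act ` topspace X)"
    by (simp add: openin_orbit_class_space)
  then show ?thesis
    by (meson openin_orbit_class_space openin_subset openin_topspace subset_antisym)
qed

lemma quotient_map_orbit_class:
  "quotient_map X (orbit_class_space G X act) (orbit_class G X act)"
  by (auto simp: quotient_map_def topspace_orbit_class_space openin_orbit_class_space)


section \<open>Almost periodicity\<close>

definition minimal_set ::
  "('g, 'm) monoid_scheme \<Rightarrow> 'a topology \<Rightarrow> ('g \<Rightarrow> 'a \<Rightarrow> 'a) \<Rightarrow> 'a set \<Rightarrow> bool" where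
  "minimal_set G X act A \<longleftrightarrow>
    A \<subseteq> topspace X \<and> (\<forall>g\<in>carrier G. act g ` A \<subseteq> A) \<and>
    (\<forall>x\<in>A. A = orbit_closure G X act x)"

definition pointwise_almost_periodic ::
  "('g, 'm) monoid_scheme \<Rightarrow> 'a topology \<Rightarrow> ('g \<Rightarrow> 'a \<Rightarrow> 'a) \<Rightarrow> bool" where
  "pointwise_almost_periodic G X act \<longleftrightarrow>
    (\<forall>x\<in>topspace X. minimal_set G X act (orbit_closure G X act x))"

definition weakly_almost_periodic ::
  "('g, 'm) monoid_scheme \<Rightarrow> 'a topology \<Rightarrow> ('g \<Rightarrow> 'a \<Rightarrow> 'a) \<Rightarrow> bool" where
  "weakly_almost_periodic G X act \<longleftrightarrow>
    pointwise_almost_periodic G X act \<and>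
    (\<forall>A. closedin X A \<longrightarrow> closedin X (\<Union>x\<in>A. orbit_closure G X act x))"

end

theory Submission
  imports Defs
begin

text \<open>
  In an equicontinuous metric, moving a small perturbation by a group element keeps it small.
  Hence \<open>y \<in> closure (G x)\<close> already follows if points arbitrarily close to \<open>x\<close> and \<open>y\<close>
  lie in a common orbit. This one criterion gives characteristic 0, \<open>R\<close>-closedness and,
  being symmetric in \<open>x\<close> and \<open>y\<close>, minimality of orbit closures. Two points with distinct orbit
  closures are separated by the sets of points whose orbits meet small balls around them.
  If orbit closures are compact, a closed set at distance \<open>0\<close> from an orbit meets its closure.
\<close>

section \<open>Uniform estimates in an equicontinuous metric\<close>

locale equicontinuous_metric_action = continuous_action G T X act
  for G (structure) and T :: "'g topology" and X :: "'a topology"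
    and act :: "'g \<Rightarrow> 'a \<Rightarrow> 'a" +
  fixes d :: "'a \<Rightarrow> 'a \<Rightarrow> real"
  assumes metric: "Metric_space (topspace X) d"
    and mtopology_eq: "Metric_space.mtopology (topspace X) d = X"
    and equicontinuous: "\<epsilon> > 0 \<Longrightarrow> \<exists>\<delta>>0. \<forall>g\<in>carrier G. \<forall>x\<in>topspace X. \<forall>y\<in>topspace X.
           d x y < \<delta> \<longrightarrow> d (act g x) (act g y) < \<epsilon>"
begin

sublocale Metric_space "topspace X" d
  by (rule metric)

lemma act_inv_act: "\<lbrakk>g \<in> carrier G; x \<in> topspace X\<rbrakk> \<Longrightarrow> act (inv g) (act g x) = x"
  by (simp add: act_mult act_one)

text \<open>Shrinking to \<open>min \<delta> \<epsilon>\<close> lets one radius serve both before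
  the action and as a bound for an error added after it.\<close>

lemma modulus:
  assumes "\<epsilon> > 0"
  obtains \<delta> where "0 < \<delta>" "\<delta> \<le> \<epsilon>"
    "\<And>g x y. \<lbrakk>g \<in> carrier G; x \<in> topspace X; y \<in> topspace X; d x y < \<delta>\<rbrakk>
       \<Longrightarrow> d (act g x) (act g y) < \<epsilon>"
proof -
  obtain \<delta> where "\<delta> > 0" "\<forall>g\<in>carrier G. \<forall>x\<in>topspace X. \<forall>y\<in>topspace X.
      d x y < \<delta> \<longrightarrow> d (act g x) (act g y) < \<epsilon>"
    using equicontinuous[OF assms] by blast
  then show thesis
    using assms by (intro that[of "min \<delta> \<epsilon>"]) auto
qed

lemma in_orbit_closure_iff:
  assumes "x \<in> topspace X"
  shows "y \<in> orbit_closure G X act x \<longleftrightarrow>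
    y \<in> topspace X \<and> (\<forall>\<epsilon>>0. \<exists>g\<in>carrier G. d (act g x) y < \<epsilon>)"
proof -
  have "(\<exists>z\<in>orbit G act x. z \<in> mball y \<epsilon>) \<longleftrightarrow> (\<exists>g\<in>carrier G. d (act g x) y < \<epsilon>)"
    if "y \<in> topspace X" for \<epsilon>
    using that assms by (auto simp: orbit_def act_closed commute)
  then show ?thesis
    using metric_closure_of[of "orbit G act x"] by (auto simp: orbit_closure_def mtopology_eq)
qed

text \<open>The \<open>g\<close> that sends \<open>x'\<close> near \<open>y\<close> also sends
  \<open>x\<close> near \<open>y\<close>. The bound on \<open>d (act g x) (act g x')\<close> is
  uniform in \<open>g\<close>, so \<open>g\<close> may be chosen after the radius.\<close>

lemma in_orbit_closureI:
  assumes x: "x \<in> topspace X" and y: "y \<in> topspace X"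
    and near: "\<And>\<epsilon>. \<epsilon> > 0 \<Longrightarrow>
      \<exists>x'\<in>topspace X. \<exists>g\<in>carrier G. d x' x < \<epsilon> \<and> d (act g x') y < \<epsilon>"
  shows "y \<in> orbit_closure G X act x"
  unfolding in_orbit_closure_iff[OF x]
proof (intro conjI allI impI)
  fix \<epsilon> :: real assume "\<epsilon> > 0"
  \<comment> \<open>One half bounds \<open>d (act g x) (act g x')\<close> by equicontinuity, the
    other bounds \<open>d (act g x') y\<close> because
    \<open>\<delta> \<le> \<epsilon> / 2\<close>.\<close>
  then obtain \<delta> where \<delta>: "0 < \<delta>" "\<delta> \<le> \<epsilon> / 2"
    "\<And>g x y. \<lbrakk>g \<in> carrier G; x \<in> topspace X; y \<in> topspace X; d x y < \<delta>\<rbrakk>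
       \<Longrightarrow> d (act g x) (act g y) < \<epsilon> / 2"
    using modulus[of "\<epsilon> / 2"] by auto
  obtain x' g where *: "x' \<in> topspace X" "g \<in> carrier G" "d x' x < \<delta>" "d (act g x') y < \<delta>"
    using near[OF \<delta>(1)] by blast
  have "d (act g x) y \<le> d (act g x) (act g x') + d (act g x') y"
    using * x y by (simp add: triangle act_closed)
  also have "\<dots> < \<epsilon>"
    using \<delta>(3)[of g x x'] * x \<delta>(2) by (simp add: commute)
  finally show "\<exists>g\<in>carrier G. d (act g x) y < \<epsilon>"
    using * by blast
qed (rule y)

section \<open>Orbit closures as equivalence classes\<close>

lemma orbit_closure_subset: "orbit_closure G X act x \<subseteq> topspace X"
  by (simp add: orbit_closure_def closure_of_subset_topspace)

lemma act_in_orbit_closure: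
  "\<lbrakk>x \<in> topspace X; g \<in> carrier G\<rbrakk> \<Longrightarrow> act g x \<in> orbit_closure G X act x"
  by (auto simp: in_orbit_closure_iff act_closed intro!: bexI[of _ g])

text \<open>If \<open>act g x\<close> is near \<open>y\<close>, then \<open>inv g\<close> carries
  this point exactly back to \<open>x\<close>, so the second distance in the criterion is 0.\<close>

lemma orbit_closure_sym:
  assumes x: "x \<in> topspace X" and y: "y \<in> orbit_closure G X act x"
  shows "x \<in> orbit_closure G X act y"
proof (rule in_orbit_closureI)
  show Y: "y \<in> topspace X"
    using y orbit_closure_subset by blast
  fix \<epsilon> :: real assume "\<epsilon> > 0"
  then obtain g where g: "g \<in> carrier G" "d (act g x) y < \<epsilon>"
    using y in_orbit_closure_iff[OF x] by blast
  then show "\<exists>x'\<in>topspace X. \<exists>h\<in>carrier G. d x' y < \<epsilon> \<and> d (act h x') x < \<epsilon>"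
    using x \<open>\<epsilon> > 0\<close>
    by (intro bexI[of _ "act g x"] bexI[of _ "inv g"]) (auto simp: act_inv_act act_closed)
qed (rule x)

text \<open>By symmetry the orbit of \<open>y\<close> comes near \<open>x\<close> as well as near
  \<open>z\<close>, which supplies the two points of a common orbit.\<close>

lemma orbit_closure_trans:
  assumes x: "x \<in> topspace X" and y: "y \<in> orbit_closure G X act x"
    and z: "z \<in> orbit_closure G X act y"
  shows "z \<in> orbit_closure G X act x"
proof -
  have Y: "y \<in> topspace X"
    using y orbit_closure_subset by blast
  have Z: "z \<in> topspace X"
    using z orbit_closure_subset by blast
  show ?thesis
  proof (rule in_orbit_closureI[OF x Z])
    fix \<epsilon> :: real assume "\<epsilon> > 0"
    obtain g where g: "g \<in> carrier G" "d (act g y) x < \<epsilon>"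
      using orbit_closure_sym[OF x y] \<open>\<epsilon> > 0\<close> in_orbit_closure_iff[OF Y] by blast
    obtain h where h: "h \<in> carrier G" "d (act h y) z < \<epsilon>"
      using z \<open>\<epsilon> > 0\<close> in_orbit_closure_iff[OF Y] by blast
    have "act (h \<otimes> inv g) (act g y) = act h y"
      using g h Y by (simp add: act_mult act_closed m_assoc)
    then show "\<exists>x'\<in>topspace X. \<exists>k\<in>carrier G. d x' x < \<epsilon> \<and> d (act k x') z < \<epsilon>"
      using g h Y by (intro bexI[of _ "act g y"] bexI[of _ "h \<otimes> inv g"]) (auto simp: act_closed)
  qed
qed

lemma orbit_closure_eq:
  assumes "x \<in> topspace X" "y \<in> orbit_closure G X act x"
  shows "orbit_closure G X act y = orbit_closure G X act x"
proof -
  have "y \<in> topspace X"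
    using assms orbit_closure_subset by blast
  then show ?thesis
    using assms orbit_closure_trans orbit_closure_sym by blast
qed

section \<open>Characteristic 0\<close>

text \<open>Late terms of the two nets are points near \<open>x\<close> and \<open>y\<close> in a
  common orbit, as the criterion requires.\<close>

lemma prolongation_subset_orbit_closure:
  assumes x: "x \<in> topspace X"
  shows "prolongation G X act x \<subseteq> orbit_closure G X act x"
proof
  fix y assume "y \<in> prolongation G X act x"
  then obtain I :: "('a \<times> 'a) set set" and r u v where y: "y \<in> topspace X"
    and I: "directed_index I r"
    and uv: "\<And>i. i \<in> I \<Longrightarrow> u i \<in> topspace X \<and> v i \<in> orbit G act (u i)"
    and lim: "limitin X v y (tails I r)" "limitin X u x (tails I r)"
    unfolding prolongation_def by blast
  show "y \<in> orbit_closure G X act x"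
  proof (rule in_orbit_closureI[OF x y])
    fix \<epsilon> :: real assume "\<epsilon> > 0"
    have ball: "openin X (mball p \<epsilon>)" for p
      using openin_mball unfolding mtopology_eq .
    have "eventually (\<lambda>i. v i \<in> mball y \<epsilon>) (tails I r)"
      using lim(1) ball y \<open>\<epsilon> > 0\<close> unfolding limitin_def by (meson centre_in_mball_iff)
    moreover have "eventually (\<lambda>i. u i \<in> mball x \<epsilon>) (tails I r)"
      using lim(2) ball x \<open>\<epsilon> > 0\<close> unfolding limitin_def by (meson centre_in_mball_iff)
    ultimately have "eventually (\<lambda>i. v i \<in> mball y \<epsilon> \<and> u i \<in> mball x \<epsilon>) (tails I r)"
      by (rule eventually_conj)
    \<comment> \<open>A tail contains its own first index by reflexivity, so an eventual property
      holds at some index.\<close>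
    then obtain i where i: "i \<in> I" "v i \<in> mball y \<epsilon>" "u i \<in> mball x \<epsilon>"
      using I unfolding eventually_tails[OF I] directed_index_def by blast
    obtain g where "g \<in> carrier G" "v i = act g (u i)"
      using uv[OF i(1)] by (auto simp: orbit_def)
    then show "\<exists>x'\<in>topspace X. \<exists>g\<in>carrier G. d x' x < \<epsilon> \<and> d (act g x') y < \<epsilon>"
      using i by (auto simp: commute intro!: bexI[of _ "u i"] bexI[of _ g])
  qed
qed

text \<open>In a metric space a point of the closure is the limit of a sequence in the orbit. This
  sequence is paired with the constant net at \<open>x\<close>; \<open>prolongationI\<close> accepts
  \<open>nat\<close> as index set.\<close>

lemma orbit_closure_subset_prolongation:
  assumes x: "x \<in> topspace X"
  shows "orbit_closure G X act x \<subseteq> prolongation G X act x"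
proof
  fix y assume "y \<in> orbit_closure G X act x"
  then obtain v where v: "range v \<subseteq> orbit G act x \<inter> topspace X" "limitin X v y sequentially"
    using closure_of_sequentially[of "orbit G act x"]
    unfolding orbit_closure_def mtopology_eq by blast
  have dir: "directed_index (UNIV :: nat set) (\<le>)"
    by (auto simp: directed_index_def intro: max.cobounded1 max.cobounded2)
  have tails: "tails (UNIV :: nat set) (\<le>) = sequentially"
    by (simp add: filter_eq_iff eventually_tails[OF dir] eventually_sequentially)
  show "y \<in> prolongation G X act x"
    by (rule prolongationI[OF dir, of "\<lambda>_. x" X v]) (use x v in \<open>auto simp: tails\<close>)
qed

lemma characteristic_0: "characteristic_0 G X act"
  using prolongation_subset_orbit_closure orbit_closure_subset_prolongation
  unfolding characteristic_0_def by blast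

section \<open>R-closedness\<close>

text \<open>A pair in the closure of \<open>R\<close> is approximated by some
  \<open>(x', y')\<close> in \<open>R\<close>. Here \<open>y'\<close> need only be a limit of orbit
  points, so one more small error is spent to reach a genuine orbit point
  \<open>act g x'\<close>.\<close>

lemma R_closed: "R_closed_action G X act"
proof -
  define R where "R = {(x, y). x \<in> topspace X \<and> y \<in> topspace X \<and> y \<in> orbit_closure G X act x}"
  have "prod_topology X X closure_of R \<subseteq> R"
  proof (rule subrelI)
    fix x y assume xy: "(x, y) \<in> prod_topology X X closure_of R"
    then have x: "x \<in> topspace X" and y: "y \<in> topspace X"
      by (auto simp: in_closure_of)
    have "y \<in> orbit_closure G X act x"
    proof (rule in_orbit_closureI[OF x y])
      fix \<epsilon> :: real assume \<epsilon>: "\<epsilon> > 0"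
      \<comment> \<open>Half radii, since the path from \<open>act g x'\<close> to \<open>y\<close>
        goes through \<open>y'\<close>.\<close>
      have "openin (prod_topology X X) (mball x (\<epsilon> / 2) \<times> mball y (\<epsilon> / 2))"
        using openin_mball by (simp add: openin_prod_Times_iff mtopology_eq)
      moreover have "(x, y) \<in> mball x (\<epsilon> / 2) \<times> mball y (\<epsilon> / 2)"
        using x y \<epsilon> by simp
      ultimately have "\<exists>p\<in>R. p \<in> mball x (\<epsilon> / 2) \<times> mball y (\<epsilon> / 2)"
        using xy[unfolded in_closure_of, THEN conjunct2, rule_format] by meson
      then obtain x' y' where "(x', y') \<in> R"
          "(x', y') \<in> mball x (\<epsilon> / 2) \<times> mball y (\<epsilon> / 2)"
        by auto
      then have x': "x' \<in> topspace X" "d x x' < \<epsilon> / 2" and y': "y' \<in> topspace X" "d y y' < \<epsilon> / 2"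
        and "y' \<in> orbit_closure G X act x'"
        by (auto simp: R_def)
      then obtain g where g: "g \<in> carrier G" "d (act g x') y' < \<epsilon> / 2"
        using \<epsilon> in_orbit_closure_iff[OF x'(1)] half_gt_zero by blast
      have "d (act g x') y \<le> d (act g x') y' + d y y'"
        using g x' y y' by (simp add: triangle' act_closed)
      then have "d (act g x') y < \<epsilon>"
        using g y' by linarith
      moreover have "d x' x < \<epsilon>"
        using x' \<epsilon> by (simp add: commute)
      ultimately show "\<exists>x'\<in>topspace X. \<exists>g\<in>carrier G. d x' x < \<epsilon> \<and> d (act g x') y < \<epsilon>"
        using x' g by blast
    qed
    then show "(x, y) \<in> R"
      using x y by (simp add: R_def)
  qed
  moreover have "R \<subseteq> topspace (prod_topology X X)"
    by (auto simp: R_def)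
  ultimately show ?thesis
    unfolding R_closed_action_def R_def[symmetric] by (simp add: closure_of_subset_eq[symmetric])
qed

section \<open>Separation of orbit classes\<close>

text \<open>For \<open>x\<close> in the space this is the union of all translates of
  \<open>mball x \<epsilon>\<close>, the smallest invariant set containing that ball.\<close>

definition orbit_nbhd :: "'a \<Rightarrow> real \<Rightarrow> 'a set" where
  "orbit_nbhd x \<epsilon> = {z \<in> topspace X. \<exists>g\<in>carrier G. d (act g z) x < \<epsilon>}"

lemma orbit_nbhd_subset: "orbit_nbhd x \<epsilon> \<subseteq> topspace X"
  by (auto simp: orbit_nbhd_def)

lemma self_in_orbit_nbhd: "\<lbrakk>x \<in> topspace X; \<epsilon> > 0\<rbrakk> \<Longrightarrow> x \<in> orbit_nbhd x \<epsilon>"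
  by (auto simp: orbit_nbhd_def act_one intro!: bexI[of _ \<one>])

lemma openin_orbit_nbhd:
  assumes x: "x \<in> topspace X"
  shows "openin X (orbit_nbhd x \<epsilon>)"
proof -
  have "\<exists>r>0. mball z r \<subseteq> orbit_nbhd x \<epsilon>" if z_in: "z \<in> orbit_nbhd x \<epsilon>" for z
  proof -
    obtain g where z: "z \<in> topspace X" and g: "g \<in> carrier G" "d (act g z) x < \<epsilon>"
      using z_in unfolding orbit_nbhd_def by blast
    \<comment> \<open>The accuracy is the slack left by \<open>act g z\<close> inside the ball
      around \<open>x\<close>, so the same \<open>g\<close> works for all points near
      \<open>z\<close>.\<close>
    obtain \<delta> where \<delta>: "0 < \<delta>" "\<delta> \<le> \<epsilon> - d (act g z) x"
      "\<And>h u v. \<lbrakk>h \<in> carrier G; u \<in> topspace X; v \<in> topspace X; d u v < \<delta>\<rbrakk>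
         \<Longrightarrow> d (act h u) (act h v) < \<epsilon> - d (act g z) x"
      using modulus[of "\<epsilon> - d (act g z) x"] g(2) by auto
    have "w \<in> orbit_nbhd x \<epsilon>" if "w \<in> mball z \<delta>" for w
    proof -
      have w: "w \<in> topspace X" "d w z < \<delta>"
        using that by (auto simp: commute)
      have "d (act g w) x \<le> d (act g w) (act g z) + d (act g z) x"
        using w z x g by (simp add: triangle act_closed)
      then have "d (act g w) x < \<epsilon>"
        using \<delta>(3)[OF g(1) w(1) z w(2)] by linarith
      then show ?thesis
        using w g by (auto simp: orbit_nbhd_def)
    qed
    then show ?thesis
      using \<delta>(1) by blast
  qed
  then show ?thesis
    using orbit_nbhd_subset openin_mtopology[of "orbit_nbhd x \<epsilon>"] unfolding mtopology_eq by auto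
qed

text \<open>Passing to the quotient needs whole orbit classes, not just orbits. The orbit of
  \<open>w\<close> accumulates at \<open>act g z\<close>, so it enters the open ball around
  \<open>x\<close> too.\<close>

lemma orbit_nbhd_saturated:
  assumes x: "x \<in> topspace X" and z: "z \<in> orbit_nbhd x \<epsilon>"
    and w: "w \<in> topspace X" "orbit_closure G X act w = orbit_closure G X act z"
  shows "w \<in> orbit_nbhd x \<epsilon>"
proof -
  obtain g where Z: "z \<in> topspace X" and g: "g \<in> carrier G" "d (act g z) x < \<epsilon>"
    using z by (auto simp: orbit_nbhd_def)
  have "act g z \<in> orbit_closure G X act w"
    using act_in_orbit_closure[OF Z g(1)] w(2) by simp
  then obtain h where h: "h \<in> carrier G" "d (act h w) (act g z) < \<epsilon> - d (act g z) x"
    using g(2) in_orbit_closure_iff[OF w(1)] diff_gt_0_iff_gt by blast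
  have "d (act h w) x \<le> d (act h w) (act g z) + d (act g z) x"
    using x w(1) Z g h by (simp add: triangle act_closed)
  then show ?thesis
    using h w by (force simp: orbit_nbhd_def)
qed

text \<open>The radius is one at which the criterion fails. A common point would have orbit points
  near both \<open>x\<close> and \<open>y\<close>, contradicting that failure.\<close>

lemma orbit_nbhd_disjoint:
  assumes x: "x \<in> topspace X" and y: "y \<in> topspace X" and notin: "y \<notin> orbit_closure G X act x"
  obtains \<epsilon> where "\<epsilon> > 0" "orbit_nbhd x \<epsilon> \<inter> orbit_nbhd y \<epsilon> = {}"
proof -
  have "\<exists>\<epsilon>>0. \<not> (\<exists>x'\<in>topspace X. \<exists>g\<in>carrier G. d x' x < \<epsilon> \<and> d (act g x') y < \<epsilon>)"
    using in_orbit_closureI[OF x y] notin by blast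
  then obtain \<epsilon> where \<epsilon>: "\<epsilon> > 0"
    "\<And>x' g. \<lbrakk>x' \<in> topspace X; g \<in> carrier G; d x' x < \<epsilon>\<rbrakk> \<Longrightarrow> \<not> d (act g x') y < \<epsilon>"
    by blast
  have False if z_in: "z \<in> orbit_nbhd x \<epsilon>" "z \<in> orbit_nbhd y \<epsilon>" for z
  proof -
    obtain g h where z: "z \<in> topspace X" and g: "g \<in> carrier G" "d (act g z) x < \<epsilon>"
      and h: "h \<in> carrier G" "d (act h z) y < \<epsilon>"
      using z_in unfolding orbit_nbhd_def by blast
    have "act (h \<otimes> inv g) (act g z) = act h z"
      using g h z by (simp add: act_mult act_closed m_assoc)
    then show False
      using \<epsilon>(2)[of "act g z" "h \<otimes> inv g"] g h z by (simp add: act_closed)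
  qed
  then show thesis
    using \<epsilon>(1) that by blast
qed

lemma Hausdorff_orbit_class_space: "Hausdorff_space (orbit_class_space G X act)"
  unfolding Hausdorff_space_def topspace_orbit_class_space
proof (intro allI impI)
  let ?q = "orbit_class G X act"
  fix a b assume ab: "a \<in> ?q ` topspace X \<and> b \<in> ?q ` topspace X \<and> a \<noteq> b"
  then obtain x y where x: "x \<in> topspace X" "a = ?q x" and y: "y \<in> topspace X" "b = ?q y"
    by blast
  \<comment> \<open>Otherwise the two orbit closures, and hence the two classes, would
    coincide.\<close>
  have "y \<notin> orbit_closure G X act x"
    using orbit_closure_eq[OF x(1)] ab x y by (auto simp: orbit_class_def)
  then obtain \<epsilon> where \<epsilon>: "\<epsilon> > 0" and disj: "orbit_nbhd x \<epsilon> \<inter> orbit_nbhd y \<epsilon> = {}"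
    using orbit_nbhd_disjoint x(1) y(1) by metis
  \<comment> \<open>Saturation makes each set the full preimage of its image, which gives both
    openness and disjointness of the images in the quotient.\<close>
  have preimage: "{w \<in> topspace X. ?q w \<in> ?q ` orbit_nbhd p \<epsilon>} = orbit_nbhd p \<epsilon>"
    if "p \<in> topspace X" for p
  proof (intro equalityI subsetI)
    fix w assume "w \<in> {w \<in> topspace X. ?q w \<in> ?q ` orbit_nbhd p \<epsilon>}"
    then obtain z where "w \<in> topspace X" "z \<in> orbit_nbhd p \<epsilon>" "?q w = ?q z"
      by blast
    moreover from this have "orbit_closure G X act w = orbit_closure G X act z"
      unfolding orbit_class_def by blast
    ultimately show "w \<in> orbit_nbhd p \<epsilon>"
      using orbit_nbhd_saturated that by blast
  qed (use orbit_nbhd_subset in blast)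
  have "openin (orbit_class_space G X act) (?q ` orbit_nbhd p \<epsilon>)" if "p \<in> topspace X" for p
    unfolding openin_orbit_class_space preimage[OF that]
    using openin_orbit_nbhd[OF that] orbit_nbhd_subset by blast
  moreover have "disjnt (?q ` orbit_nbhd x \<epsilon>) (?q ` orbit_nbhd y \<epsilon>)"
    using preimage[OF x(1)] preimage[OF y(1)] disj unfolding disjnt_def by blast
  ultimately show "\<exists>U V. openin (orbit_class_space G X act) U \<and>
      openin (orbit_class_space G X act) V \<and> a \<in> U \<and> b \<in> V \<and> disjnt U V"
    using x y \<epsilon> self_in_orbit_nbhd by (meson imageI)
qed

section \<open>Almost periodicity\<close>

lemma pointwise_almost_periodic: "pointwise_almost_periodic G X act"
  unfolding pointwise_almost_periodic_def minimal_set_def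
proof (intro ballI conjI orbit_closure_subset)
  fix x g assume x: "x \<in> topspace X" and g: "g \<in> carrier G"
  show "act g ` orbit_closure G X act x \<subseteq> orbit_closure G X act x"
    using act_in_orbit_closure[OF _ g] orbit_closure_trans[OF x] orbit_closure_subset by blast
qed (use orbit_closure_eq in blast)

text \<open>The complement of \<open>A\<close> alone is an open cover of the compact orbit closure;
  its Lebesgue number is the required distance.\<close>

lemma orbit_near_disjoint_closed:
  assumes A: "closedin X A" and x: "x \<in> topspace X"
    and comp: "compactin X (orbit_closure G X act x)"
    and disj: "orbit_closure G X act x \<inter> A = {}"
  obtains \<epsilon> where "\<epsilon> > 0" "\<And>g a. \<lbrakk>g \<in> carrier G; a \<in> A\<rbrakk> \<Longrightarrow> \<epsilon> \<le> d (act g x) a"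
proof -
  have "orbit_closure G X act x \<subseteq> topspace X - A"
    using disj orbit_closure_subset by blast
  then obtain \<epsilon> where \<epsilon>: "\<epsilon> > 0" "\<And>y. y \<in> orbit_closure G X act x \<Longrightarrow> mball y \<epsilon> \<subseteq> topspace X - A"
    using lebesgue_number[of "orbit_closure G X act x" "{topspace X - A}"] A comp
      openin_diff[OF openin_topspace A]
    unfolding mtopology_eq by auto
  show thesis
  proof
    fix g a assume "g \<in> carrier G" "a \<in> A"
    then show "\<epsilon> \<le> d (act g x) a"
      using \<epsilon>(2)[OF act_in_orbit_closure[OF x]] closedin_subset[OF A] x
      by (force simp: act_closed subset_iff)
  qed (rule \<epsilon>(1))
qed

lemma closedin_saturation:
  assumes comp: "\<And>x. x \<in> topspace X \<Longrightarrow> compactin X (orbit_closure G X act x)"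
    and A: "closedin X A"
  shows "closedin X (\<Union>x\<in>A. orbit_closure G X act x)"
proof -
  let ?S = "\<Union>x\<in>A. orbit_closure G X act x"
  have AX: "A \<subseteq> topspace X"
    using A closedin_subset by blast
  have "X closure_of ?S \<subseteq> ?S"
  proof
    fix y assume y: "y \<in> X closure_of ?S"
    then have Y: "y \<in> topspace X"
      by (simp add: in_closure_of)
    \<comment> \<open>This suffices: symmetry turns a point of \<open>A\<close> in the orbit closure
      of \<open>y\<close> into one whose orbit closure contains \<open>y\<close>.\<close>
    have "orbit_closure G X act y \<inter> A \<noteq> {}"
    proof
      assume "orbit_closure G X act y \<inter> A = {}"
      then obtain \<epsilon> where \<epsilon>: "\<epsilon> > 0"
        "\<And>g a. \<lbrakk>g \<in> carrier G; a \<in> A\<rbrakk> \<Longrightarrow> \<epsilon> \<le> d (act g y) a"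
        using orbit_near_disjoint_closed[OF A Y comp[OF Y]] by metis
      obtain \<delta> where \<delta>: "0 < \<delta>" "\<delta> \<le> \<epsilon>"
        "\<And>g x y. \<lbrakk>g \<in> carrier G; x \<in> topspace X; y \<in> topspace X; d x y < \<delta>\<rbrakk>
           \<Longrightarrow> d (act g x) (act g y) < \<epsilon>"
        using modulus[of \<epsilon>] \<epsilon>(1) by auto
      \<comment> \<open>Half of \<open>\<delta>\<close> covers the way from \<open>y\<close> to
        \<open>z\<close>, the other half the way from \<open>z\<close> to
        \<open>act g a\<close>.\<close>
      obtain z where "z \<in> ?S" and z: "z \<in> mball y (\<delta> / 2)"
        using y metric_closure_of[of ?S] half_gt_zero[OF \<delta>(1)] unfolding mtopology_eq by blast
      then obtain a where a: "a \<in> A" "z \<in> orbit_closure G X act a"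
        by blast
      then have X: "a \<in> topspace X" "z \<in> topspace X"
        using AX z by auto
      obtain g where g: "g \<in> carrier G" "d (act g a) z < \<delta> / 2"
        using a(2) half_gt_zero[OF \<delta>(1)] in_orbit_closure_iff[OF X(1)] by blast
      have "d y (act g a) \<le> d y z + d (act g a) z"
        using Y X g by (simp add: triangle' act_closed)
      then have "d y (act g a) < \<delta>"
        using g z by simp
      \<comment> \<open>Pulling back by \<open>inv g\<close> brings an orbit point of
        \<open>y\<close> within \<open>\<epsilon>\<close> of \<open>a\<close> itself, against the
        choice of \<open>\<epsilon>\<close>.\<close>
      then have "d (act (inv g) y) (act (inv g) (act g a)) < \<epsilon>"
        using g Y X by (intro \<delta>(3)) (auto simp: act_closed)
      then show False
        using \<epsilon>(2)[of "inv g" a] g a X by (simp add: act_inv_act)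
    qed
    then obtain a where a: "a \<in> A" "a \<in> orbit_closure G X act y"
      by blast
    then show "y \<in> ?S"
      using orbit_closure_sym[OF Y] by blast
  qed
  moreover have "?S \<subseteq> topspace X"
    using orbit_closure_subset by blast
  ultimately show ?thesis
    by (simp add: closure_of_subset_eq[symmetric])
qed

end

theorem corollary3p10:
  fixes G :: "('g, 'm) monoid_scheme" and T :: "'g topology"
    and X :: "'a topology" and act :: "'g \<Rightarrow> 'a \<Rightarrow> 'a"
  assumes "metrizable_space X"
    and "topological_group G T"
    and "continuous_action G T X act"
    and "equicontinuous_action G X act"
  shows "characteristic_0 G X act \<and>
    R_closed_action G X act \<and>
    Hausdorff_space (orbit_class_space G X act) \<and>
    ((\<forall>x\<in>topspace X. compactin X (orbit_closure G X act x)) \<longrightarrow>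
       weakly_almost_periodic G X act)"
proof -
  obtain d where d: "Metric_space (topspace X) d" "Metric_space.mtopology (topspace X) d = X"
    "\<forall>\<epsilon>>0. \<exists>\<delta>>0. \<forall>g\<in>carrier G. \<forall>x\<in>topspace X. \<forall>y\<in>topspace X.
       d x y < \<delta> \<longrightarrow> d (act g x) (act g y) < \<epsilon>"
    using assms(4) unfolding equicontinuous_action_def by blast
  \<comment> \<open>The metric fixed here is the one witnessing equicontinuity.\<close>
  interpret equicontinuous_metric_action G T X act d
    by (intro equicontinuous_metric_action.intro equicontinuous_metric_action_axioms.intro
        assms(3) d(1,2)) (use d(3) in blast)
  show ?thesis
    using characteristic_0 R_closed Hausdorff_orbit_class_space pointwise_almost_periodic
      closedin_saturation
    unfolding weakly_almost_periodic_def by blast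
qed

end
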